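(* Suppose that $\mu\in\mathbb{R}$ and $\sigma>0$ are known parameters and $\alpha$ is unknown, and let $\Theta=\{\alpha\in\mathbb{R}:|\alpha|>0\}$ be the parameter space for $\alpha$. Let $X_1,X_2,\ldots$ be i.i.d. with distribution BN$(\mu,\sigma,\alpha)$, where $\alpha\in\Theta$ is the true parameter, and let $\boldsymbol{X}=(X_1,\ldots,X_n)$. Then, with probability approaching $1$ as $n\to+\infty$, the log-likelihood equation $\partial l(\boldsymbol{\theta};\boldsymbol{X})/\partial\alpha=0$ has a consistent solution, denoted by $\widehat\alpha$ (that is, a solution $\widehat\alpha=\widehat\alpha_n$ converging in probability to the true value $\alpha$ as $n\to+\infty$).
   Context: BN$(\boldsymbol{\theta})$, $\boldsymbol{\theta}=(\mu,\sigma,\alpha)$ with $\mu\in\mathbb{R}$, $\sigma>0$, $\alpha\in\mathbb{R}$, is the distribution on $\mathbb{R}$ with PDF $$f(x;\boldsymbol{\theta})=\frac{1}{\sqrt{2\pi\sigma^2}}\exp\left[-\frac12\left(\frac{x-\mu}{\sigma}\right)^2-\frac{\alpha^2}{2}\right]\cosh\left[\alpha\left(\frac{x-\mu}{\sigma}\right)\right],\quad x\in\mathbb{R}.$$ The log-likelihood function is $l(\boldsymbol{\theta};\boldsymbol{X})=\sum_{i=1}^n\log f(X_i;\boldsymbol{\theta})$, so that $$\frac{\partial l(\boldsymbol{\theta};\boldsymbol{X})}{\partial\alpha}=-\alpha n+\sum_{i=1}^n\left(\frac{X_i-\mu}{\sigma}\right)\tanh\left[\alpha\left(\frac{X_i-\mu}{\sigma}\right)\right].$$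 *)

theory Defs
  imports "HOL-Probability.Probability"
begin

definition bn_density :: "real \<Rightarrow> real \<Rightarrow> real \<Rightarrow> real \<Rightarrow> real" where
  "bn_density \<mu> \<sigma> \<alpha> x =
     1 / sqrt (2 * pi * \<sigma>\<^sup>2) * exp (- (1/2) * ((x - \<mu>) / \<sigma>)\<^sup>2 - \<alpha>\<^sup>2 / 2)
       * cosh (\<alpha> * ((x - \<mu>) / \<sigma>))"

(* Observations are numbered from 0. *)
definition bn_loglik :: "real \<Rightarrow> real \<Rightarrow> nat \<Rightarrow> (nat \<Rightarrow> real) \<Rightarrow> real \<Rightarrow> real" where
  "bn_loglik \<mu> \<sigma> n x \<alpha> = (\<Sum>i<n. ln (bn_density \<mu> \<sigma> \<alpha> (x i)))"

definition bn_alpha_space :: "real set" where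
  "bn_alpha_space = {\<alpha>. \<bar>\<alpha>\<bar> > 0}"

(* A solution is sought in the parameter space: by symmetry of the density in \<alpha>, the point 0
   always solves the equation. *)
definition bn_lik_root :: "real \<Rightarrow> real \<Rightarrow> nat \<Rightarrow> (nat \<Rightarrow> real) \<Rightarrow> real \<Rightarrow> bool" where
  "bn_lik_root \<mu> \<sigma> n x a \<longleftrightarrow>
     a \<in> bn_alpha_space \<and> (bn_loglik \<mu> \<sigma> n x has_real_derivative 0) (at a)"

(* Undefined outside {..<n}, so that samples of size n are points of the product space over {..<n}. *)
definition sample :: "(nat \<Rightarrow> 'a \<Rightarrow> real) \<Rightarrow> nat \<Rightarrow> 'a \<Rightarrow> nat \<Rightarrow> real" where
  "sample X n \<omega> = (\<lambda>i\<in>{..<n}. X i \<omega>)"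

definition tendsto_in_prob :: "'a measure \<Rightarrow> (nat \<Rightarrow> 'a \<Rightarrow> real) \<Rightarrow> real \<Rightarrow> bool" where
  "tendsto_in_prob M Y c \<longleftrightarrow>
     (\<forall>n. Y n \<in> borel_measurable M) \<and>
     (\<forall>\<epsilon>>0. (\<lambda>n. measure M {\<omega> \<in> space M. \<bar>Y n \<omega> - c\<bar> > \<epsilon>}) \<longlonglongrightarrow> 0)"

lemma bn_loglik_has_derivative:
  assumes "\<sigma> > 0"
  shows "(bn_loglik \<mu> \<sigma> n x has_real_derivative
    (- a * real n + (\<Sum>i<n. (x i - \<mu>) / \<sigma> * tanh (a * ((x i - \<mu>) / \<sigma>))))) (at a)"
proof -
  have "((\<lambda>a. ln (bn_density \<mu> \<sigma> a (x i))) has_real_derivative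
      (- a + (x i - \<mu>) / \<sigma> * tanh (a * ((x i - \<mu>) / \<sigma>)))) (at a)" for i
  proof -
    define y where "y = (x i - \<mu>) / \<sigma>"
    have eq: "ln (bn_density \<mu> \<sigma> a (x i)) =
        ln (1 / sqrt (2 * pi * \<sigma>\<^sup>2)) + (- (1/2) * y\<^sup>2 - a\<^sup>2 / 2) + ln (cosh (a * y))" for a
      using assms by (simp add: bn_density_def y_def ln_mult ln_div cosh_real_pos)
    have pos: "cosh (a * y) > 0" by (rule cosh_real_pos)
    have "((\<lambda>a. ln (1 / sqrt (2 * pi * \<sigma>\<^sup>2)) + (- (1/2) * y\<^sup>2 - a\<^sup>2 / 2) + ln (cosh (a * y)))
        has_real_derivative (- a + y * tanh (a * y))) (at a)"
      using pos by (auto intro!: derivative_eq_intros simp: tanh_def field_simps)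
    then show ?thesis unfolding eq by (simp add: y_def)
  qed
  then have "((\<lambda>a. \<Sum>i<n. ln (bn_density \<mu> \<sigma> a (x i))) has_real_derivative
      (\<Sum>i<n. (- a + (x i - \<mu>) / \<sigma> * tanh (a * ((x i - \<mu>) / \<sigma>))))) (at a)"
    by (intro DERIV_sum) auto
  then show ?thesis
    unfolding bn_loglik_def by (simp add: sum.distrib sum_subtractf sum_negf mult.commute)
qed

end

(* Write y = (x - \<mu>)/\<sigma> and s(a) = \<Sum> y_i tanh(a y_i) - n a for the score. Since tanh t / t is
   strictly decreasing for t > 0, so is s(a)/a, hence s has at most one positive root, and it
   lies between any l < u with s(l) > 0 > s(u). The density is the equal mixture of N(\<mu> \<plusminus> \<sigma>\<alpha>, \<sigma>\<^sup>2),
   so E[y tanh(\<alpha> y)] = \<alpha>; by the same monotonicity E[y tanh(a y)] - a is positive for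
   0 < a < |\<alpha>| and negative for a > |\<alpha>|. The weak law of large numbers then puts the positive
   root close to |\<alpha>| with probability tending to 1. The estimator may depend on the true \<alpha>, so
   it picks the root of the right sign: the density is even in \<alpha>, so the data cannot tell the
   two signs apart. *)
theory Submission
  imports Defs
begin

section \<open>Strict monotonicity of tanh t / t\<close>

text \<open>The derivative of tanh z / z has the sign of z - sinh z cosh z. This is negative for z >
  0, because sinh z cosh z - z vanishes at 0 and has derivative 2 sinh z sinh z > 0.\<close>

lemma tanh_quotient_strict_antimono:
  fixes s t :: real
  assumes "0 < s" "s < t"
  shows "s * tanh t < t * tanh s"
proof -
  let ?f = "\<lambda>x::real. sinh x * cosh x - x"
  have pos: "?f x > 0" if "x > 0" for x
  proof -
    have "?f 0 < ?f x"
    proof (rule DERIV_pos_imp_increasing_open[OF that])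
      fix z :: real assume "0 < z" "z < x"
      have "(?f has_real_derivative (cosh z * cosh z + sinh z * sinh z - 1)) (at z)"
        by (auto intro!: derivative_eq_intros)
      moreover have "cosh z * cosh z = 1 + sinh z * sinh z"
        using cosh_square_eq[of z] by (simp add: power2_eq_square)
      moreover have "sinh z * sinh z > 0" using \<open>0 < z\<close> by simp
      ultimately show "\<exists>y. (?f has_real_derivative y) (at z) \<and> 0 < y"
        by (intro exI[of _ "cosh z * cosh z + sinh z * sinh z - 1"]) auto
    qed (auto intro!: continuous_intros)
    then show ?thesis by simp
  qed
  have "tanh t / t < tanh s / s"
  proof (rule DERIV_neg_imp_decreasing[OF assms(2)])
    fix z assume z: "s \<le> z" "z \<le> t"
    then have z0: "z > 0" using assms by simp
    have c: "cosh z > 0" by (rule cosh_real_pos)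
    let ?d = "((1 - (tanh z)\<^sup>2) * z - tanh z) / z\<^sup>2"
    have "((\<lambda>z. tanh z / z) has_real_derivative ?d) (at z)"
      using z0 c by (auto intro!: derivative_eq_intros simp: power2_eq_square)
    moreover have "?d < 0"
    proof -
      have "(1 - (tanh z)\<^sup>2) * z - tanh z = (z - sinh z * cosh z) / (cosh z)\<^sup>2"
      proof -
        have "1 - (tanh z)\<^sup>2 = 1 / (cosh z)\<^sup>2"
        proof -
          have "1 - (tanh z)\<^sup>2 = ((cosh z)\<^sup>2 - (sinh z)\<^sup>2) / (cosh z)\<^sup>2"
            using c by (simp add: tanh_def power_divide diff_divide_distrib)
          then show ?thesis by (simp add: cosh_square_eq)
        qed
        moreover have "tanh z = sinh z * cosh z / (cosh z)\<^sup>2"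
          using c by (simp add: tanh_def power2_eq_square)
        ultimately show ?thesis by (simp add: diff_divide_distrib)
      qed
      then show ?thesis using pos[OF z0] z0 c by (simp add: divide_less_0_iff)
    qed
    ultimately show "\<exists>y. ((\<lambda>z. tanh z / z) has_real_derivative y) (at z) \<and> y < 0" by blast
  qed
  then show ?thesis using assms by (simp add: field_simps)
qed

text \<open>As y tanh(b y) is even in y, the previous lemma applies with s = a |y| and t = c |y|.
  The cross-multiplied form can be summed over a sample and integrated.\<close>

lemma mult_tanh_strict_antimono:
  fixes a c y :: real
  assumes "0 < a" "a < c" "y \<noteq> 0"
  shows "a * (y * tanh (c * y)) < c * (y * tanh (a * y))"
proof -
  have ev: "y * tanh (b * y) = \<bar>y\<bar> * tanh (b * \<bar>y\<bar>)" for b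
    by (cases "y \<ge> 0") auto
  have "a * \<bar>y\<bar> * tanh (c * \<bar>y\<bar>) < c * \<bar>y\<bar> * tanh (a * \<bar>y\<bar>)"
    using assms by (intro tanh_quotient_strict_antimono) auto
  then show ?thesis unfolding ev by (simp add: mult.assoc)
qed

lemma abs_tanh_real_le_1: "\<bar>tanh (x::real)\<bar> \<le> 1"
  using tanh_real_bounds[of x] by (simp add: abs_le_iff)

section \<open>A weak law of large numbers under finite second moments\<close>

text \<open>Independence and the zero means kill the cross term in the square of the sum.
  Integrability is carried through the induction because linearity of the expectation needs it at
  each step.\<close>

lemma (in prob_space) second_moment_sum_indep:
  fixes W :: "nat \<Rightarrow> 'a \<Rightarrow> real"
  assumes ind: "indep_vars (\<lambda>_. borel) W UNIV"
    and int: "\<And>i. integrable M (W i)" and int2: "\<And>i. integrable M (\<lambda>\<omega>. (W i \<omega>)\<^sup>2)"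
    and mean: "\<And>i. expectation (W i) = 0" and var: "\<And>i. expectation (\<lambda>\<omega>. (W i \<omega>)\<^sup>2) = v"
  shows "integrable M (\<lambda>\<omega>. (\<Sum>i<n. W i \<omega>)\<^sup>2) \<and>
    expectation (\<lambda>\<omega>. (\<Sum>i<n. W i \<omega>)\<^sup>2) = real n * v"
proof (induction n)
  case (Suc n)
  have iv: "indep_var borel (W n) borel (\<lambda>\<omega>. \<Sum>i\<in>{..<n}. W i \<omega>)"
    by (rule indep_vars_sum) (auto intro: indep_vars_subset[OF ind])
  have ints: "integrable M (\<lambda>\<omega>. \<Sum>i<n. W i \<omega>)" using int by auto
  have prod: "integrable M (\<lambda>\<omega>. W n \<omega> * (\<Sum>i<n. W i \<omega>))"
    by (rule indep_var_integrable[OF iv int ints])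
  have prod0: "expectation (\<lambda>\<omega>. W n \<omega> * (\<Sum>i<n. W i \<omega>)) = 0"
    using indep_var_lebesgue_integral[OF iv int ints] mean by simp
  have eq: "(\<Sum>i<Suc n. W i \<omega>)\<^sup>2 =
      (\<Sum>i<n. W i \<omega>)\<^sup>2 + (2 * (W n \<omega> * (\<Sum>i<n. W i \<omega>)) + (W n \<omega>)\<^sup>2)" for \<omega>
    by (simp add: power2_eq_square algebra_simps)
  show ?case unfolding eq
    using Suc prod prod0 int2 var by (simp add: algebra_simps)
qed simp

text \<open>Chebyshev's inequality for the centred sum, whose variance grows only linearly in n.
  Sums are not divided by n, which matches the form of the score.\<close>

lemma (in prob_space) weak_law_of_large_numbers:
  fixes Z :: "nat \<Rightarrow> 'a \<Rightarrow> real"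
  assumes ind: "indep_vars (\<lambda>_. borel) Z UNIV"
    and int2: "\<And>i. integrable M (\<lambda>\<omega>. (Z i \<omega>)\<^sup>2)"
    and mean: "\<And>i. expectation (Z i) = m" and mom: "\<And>i. expectation (\<lambda>\<omega>. (Z i \<omega>)\<^sup>2) = s"
    and "e > 0"
  shows "(\<lambda>n. prob {\<omega> \<in> space M. \<bar>(\<Sum>i<n. Z i \<omega>) - real n * m\<bar> \<ge> real n * e}) \<longlonglongrightarrow> 0"
proof -
  have rv[measurable]: "random_variable borel (Z i)" for i
    using ind by (auto simp: indep_vars_def)
  have int: "integrable M (Z i)" for i
    by (rule square_integrable_imp_integrable[OF rv int2])
  define W where "W i \<omega> = Z i \<omega> - m" for i \<omega>
  have indW: "indep_vars (\<lambda>_. borel) W UNIV"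
    unfolding W_def by (rule indep_vars_compose2[OF ind]) auto
  have intW: "integrable M (W i)" for i unfolding W_def using int by simp
  have sq: "(W i \<omega>)\<^sup>2 = (Z i \<omega>)\<^sup>2 - 2 * m * Z i \<omega> + m\<^sup>2" for i \<omega>
    by (simp add: W_def power2_eq_square algebra_simps)
  have W2: "integrable M (\<lambda>\<omega>. (W i \<omega>)\<^sup>2)" for i unfolding sq using int int2 by simp
  have EW: "expectation (W i) = 0" for i
    unfolding W_def using int mean by (simp add: prob_space)
  have VW: "expectation (\<lambda>\<omega>. (W i \<omega>)\<^sup>2) = s - m\<^sup>2" for i
    unfolding sq using int int2 mean mom by (simp add: prob_space power2_eq_square)
  note S = second_moment_sum_indep[OF indW intW W2 EW VW]
  have rvW[measurable]: "random_variable borel (W i)" for i unfolding W_def by simp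
  \<comment> \<open>For n = 0 the event is the whole space while the bound is 0 (division by zero),
    so the estimate is claimed for positive n only.\<close>
  have bound: "prob {\<omega> \<in> space M. \<bar>(\<Sum>i<n. Z i \<omega>) - real n * m\<bar> \<ge> real n * e}
      \<le> (s - m\<^sup>2) / e\<^sup>2 * (1 / real n)" if "n > 0" for n
  proof -
    let ?S = "\<lambda>\<omega>. \<Sum>i<n. W i \<omega>"
    have E0: "expectation ?S = 0" using intW EW by simp
    have "prob {\<omega> \<in> space M. \<bar>?S \<omega> - expectation ?S\<bar> \<ge> real n * e}
        \<le> variance ?S / (real n * e)\<^sup>2"
      using S that \<open>e > 0\<close> by (intro Chebyshev_inequality) auto
    also have "\<dots> = (s - m\<^sup>2) / e\<^sup>2 * (1 / real n)"
      unfolding E0 using S that by (simp add: power2_eq_square)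
    finally show ?thesis unfolding E0 by (simp add: W_def sum_subtractf)
  qed
  have "(\<lambda>n. (s - m\<^sup>2) / e\<^sup>2 * (1 / real n)) \<longlonglongrightarrow> (s - m\<^sup>2) / e\<^sup>2 * 0"
    by (intro tendsto_intros lim_1_over_n)
  then have lim: "(\<lambda>n. (s - m\<^sup>2) / e\<^sup>2 * (1 / real n)) \<longlonglongrightarrow> 0" by simp
  show ?thesis
  proof (rule tendsto_sandwich[OF _ _ tendsto_const lim])
    show "\<forall>\<^sub>F n in sequentially. prob {\<omega> \<in> space M. \<bar>(\<Sum>i<n. Z i \<omega>) - real n * m\<bar> \<ge> real n * e}
        \<le> (s - m\<^sup>2) / e\<^sup>2 * (1 / real n)"
      using eventually_gt_at_top[of 0] by (rule eventually_mono) (rule bound)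
  qed simp
qed

section \<open>The density as a normal mixture, and its moments\<close>

text \<open>Completing the square turns each exponential in cosh into a normal density. The factor
  tanh replaces cosh by sinh, hence the sum of the two components by their difference.\<close>

lemma bn_density_eq_normal_mixture:
  assumes "\<sigma> > 0"
  shows "bn_density \<mu> \<sigma> \<alpha> x =
    (normal_density (\<mu> + \<sigma> * \<alpha>) \<sigma> x + normal_density (\<mu> - \<sigma> * \<alpha>) \<sigma> x) / 2"
    and "bn_density \<mu> \<sigma> \<alpha> x * tanh (\<alpha> * ((x - \<mu>) / \<sigma>)) =
    (normal_density (\<mu> + \<sigma> * \<alpha>) \<sigma> x - normal_density (\<mu> - \<sigma> * \<alpha>) \<sigma> x) / 2"
proof -
  define y where "y = (x - \<mu>) / \<sigma>"
  have x: "x = \<mu> + \<sigma> * y" using assms by (simp add: y_def)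
  have n: "normal_density (\<mu> + \<sigma> * b) \<sigma> x =
      1 / sqrt (2 * pi * \<sigma>\<^sup>2) * (exp (- (1/2) * y\<^sup>2 - b\<^sup>2 / 2) * exp (b * y))" for b
  proof -
    have "x - (\<mu> + \<sigma> * b) = \<sigma> * (y - b)" by (simp add: x algebra_simps)
    then have "-(x - (\<mu> + \<sigma> * b))\<^sup>2 / (2 * \<sigma>\<^sup>2) = - ((y - b)\<^sup>2 / 2)"
      using assms by (simp add: power_mult_distrib)
    also have "\<dots> = (- (1/2) * y\<^sup>2 - b\<^sup>2 / 2) + b * y"
      by (simp add: power2_eq_square field_simps)
    finally show ?thesis unfolding normal_density_def by (simp add: exp_add)
  qed
  note n1 = n[of \<alpha>] and n2 = n[of "- \<alpha>", simplified]
  show "bn_density \<mu> \<sigma> \<alpha> x =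
    (normal_density (\<mu> + \<sigma> * \<alpha>) \<sigma> x + normal_density (\<mu> - \<sigma> * \<alpha>) \<sigma> x) / 2"
    unfolding n1 n2 bn_density_def y_def[symmetric] by (simp add: cosh_field_def algebra_simps add_divide_distrib)
  have "bn_density \<mu> \<sigma> \<alpha> x * tanh (\<alpha> * y) =
      1 / sqrt (2 * pi * \<sigma>\<^sup>2) * exp (- (1/2) * y\<^sup>2 - \<alpha>\<^sup>2 / 2) * sinh (\<alpha> * y)"
    unfolding bn_density_def y_def[symmetric] tanh_def using cosh_real_pos[of "\<alpha> * y"] by simp
  also have "\<dots> = (normal_density (\<mu> + \<sigma> * \<alpha>) \<sigma> x - normal_density (\<mu> - \<sigma> * \<alpha>) \<sigma> x) / 2"
    unfolding n1 n2 by (simp add: sinh_field_def algebra_simps diff_divide_distrib)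
  finally show "bn_density \<mu> \<sigma> \<alpha> x * tanh (\<alpha> * ((x - \<mu>) / \<sigma>)) =
    (normal_density (\<mu> + \<sigma> * \<alpha>) \<sigma> x - normal_density (\<mu> - \<sigma> * \<alpha>) \<sigma> x) / 2"
    unfolding y_def .
qed

lemma bn_density_nonneg: "bn_density \<mu> \<sigma> \<alpha> x \<ge> 0"
  using cosh_real_pos[of "\<alpha> * ((x - \<mu>) / \<sigma>)"] by (simp add: bn_density_def)

lemma bn_second_moment_integrable:
  assumes "\<sigma> > 0"
  shows "integrable lborel (\<lambda>x. bn_density \<mu> \<sigma> \<alpha> x * ((x - \<mu>) / \<sigma>)\<^sup>2)"
proof -
  have i: "integrable lborel (\<lambda>x. normal_density (\<mu> + c) \<sigma> x * (x - \<mu>)\<^sup>2)" for c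
  proof -
    \<comment> \<open>Expanding about the mean \<open>\<mu> + c\<close> of the component leaves
      central moments of orders 2, 1 and 0.\<close>
    have eq: "normal_density (\<mu> + c) \<sigma> x * (x - \<mu>)\<^sup>2 =
        normal_density (\<mu> + c) \<sigma> x * (x - (\<mu> + c)) ^ 2 +
        2 * c * (normal_density (\<mu> + c) \<sigma> x * (x - (\<mu> + c)) ^ 1) +
        c\<^sup>2 * normal_density (\<mu> + c) \<sigma> x" for x
      by (simp add: power2_eq_square algebra_simps)
    show ?thesis unfolding eq
      by (intro Bochner_Integration.integrable_add integrable_mult_right
          integrable_normal_moment[OF assms] integrable_normal_density[OF assms])
  qed
  have eq: "bn_density \<mu> \<sigma> \<alpha> x * ((x - \<mu>) / \<sigma>)\<^sup>2 =
      (normal_density (\<mu> + \<sigma> * \<alpha>) \<sigma> x * (x - \<mu>)\<^sup>2 +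
       normal_density (\<mu> + - (\<sigma> * \<alpha>)) \<sigma> x * (x - \<mu>)\<^sup>2) / (2 * \<sigma>\<^sup>2)" for x
    unfolding bn_density_eq_normal_mixture(1)[OF assms] by (simp add: power_divide field_simps)
  show ?thesis unfolding eq
    by (intro integrable_divide Bochner_Integration.integrable_add i)
qed

text \<open>By the second mixture identity the integral is the difference of the two component
  means, \<open>2 * \<sigma> * \<alpha>\<close>, divided by \<open>2 * \<sigma>\<close>.\<close>

lemma bn_score_mean:
  assumes "\<sigma> > 0"
  shows "(\<integral>x. bn_density \<mu> \<sigma> \<alpha> x * ((x - \<mu>) / \<sigma> * tanh (\<alpha> * ((x - \<mu>) / \<sigma>))) \<partial>lborel) = \<alpha>"
proof -
  have h: "has_bochner_integral lborel (\<lambda>x. normal_density m \<sigma> x * (x - \<mu>)) (m - \<mu>)" for m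
  proof -
    have "has_bochner_integral lborel
       (\<lambda>x. normal_density m \<sigma> x * x - normal_density m \<sigma> x * \<mu>) (m - 1 * \<mu>)"
      using assms
      by (intro has_bochner_integral_diff has_bochner_integral_mult_left normal_moment_nz_1)
        (auto simp: has_bochner_integral_iff)
    then show ?thesis by (simp add: algebra_simps)
  qed
  have eq: "bn_density \<mu> \<sigma> \<alpha> x * ((x - \<mu>) / \<sigma> * tanh (\<alpha> * ((x - \<mu>) / \<sigma>))) =
      (normal_density (\<mu> + \<sigma> * \<alpha>) \<sigma> x * (x - \<mu>) - normal_density (\<mu> - \<sigma> * \<alpha>) \<sigma> x * (x - \<mu>))
        / (2 * \<sigma>)" for x
  proof -
    have "bn_density \<mu> \<sigma> \<alpha> x * ((x - \<mu>) / \<sigma> * tanh (\<alpha> * ((x - \<mu>) / \<sigma>))) =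
       (bn_density \<mu> \<sigma> \<alpha> x * tanh (\<alpha> * ((x - \<mu>) / \<sigma>))) * ((x - \<mu>) / \<sigma>)" by simp
    then show ?thesis
      unfolding bn_density_eq_normal_mixture(2)[OF assms] using assms by (simp add: field_simps)
  qed
  have "has_bochner_integral lborel
      (\<lambda>x. (normal_density (\<mu> + \<sigma> * \<alpha>) \<sigma> x * (x - \<mu>) - normal_density (\<mu> - \<sigma> * \<alpha>) \<sigma> x * (x - \<mu>))
        / (2 * \<sigma>))
      ((((\<mu> + \<sigma> * \<alpha>) - \<mu>) - ((\<mu> - \<sigma> * \<alpha>) - \<mu>)) / (2 * \<sigma>))"
    by (intro has_bochner_integral_divide has_bochner_integral_diff h)
  then show ?thesis unfolding eq using assms by (simp add: has_bochner_integral_iff)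
qed

section \<open>The score and its positive root\<close>

definition bn_score :: "real \<Rightarrow> real \<Rightarrow> nat \<Rightarrow> (nat \<Rightarrow> real) \<Rightarrow> real \<Rightarrow> real" where
  "bn_score \<mu> \<sigma> n x a = (\<Sum>i<n. (x i - \<mu>) / \<sigma> * tanh (a * ((x i - \<mu>) / \<sigma>))) - real n * a"

text \<open>Uniqueness of derivatives turns the likelihood equation into an equation for the score;
  \<open>a \<noteq> 0\<close> is membership in the parameter space.\<close>

lemma bn_lik_root_iff:
  assumes "\<sigma> > 0"
  shows "bn_lik_root \<mu> \<sigma> n x a \<longleftrightarrow> a \<noteq> 0 \<and> bn_score \<mu> \<sigma> n x a = 0"
proof -
  have "(bn_loglik \<mu> \<sigma> n x has_real_derivative bn_score \<mu> \<sigma> n x a) (at a)"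
    using bn_loglik_has_derivative[OF assms, of \<mu> n x a] by (simp add: bn_score_def algebra_simps)
  then show ?thesis
    unfolding bn_lik_root_def bn_alpha_space_def by (auto dest: DERIV_unique)
qed

lemma bn_score_minus: "bn_score \<mu> \<sigma> n x (- a) = - bn_score \<mu> \<sigma> n x a"
  by (simp add: bn_score_def sum_negf)

text \<open>The linear terms of both sides agree, so only the tanh sums are compared. Observations
  equal to \<mu> contribute equality, and one other observation makes the inequality strict.\<close>

lemma bn_score_strict_antimono:
  assumes "\<sigma> > 0" "0 < a" "a < c" "i < n" "x i \<noteq> \<mu>"
  shows "a * bn_score \<mu> \<sigma> n x c < c * bn_score \<mu> \<sigma> n x a"
proof -
  define y where "y j = (x j - \<mu>) / \<sigma>" for j
  have "(\<Sum>j<n. a * (y j * tanh (c * y j))) < (\<Sum>j<n. c * (y j * tanh (a * y j)))"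
  proof (rule sum_strict_mono_ex1)
    have "a * (y j * tanh (c * y j)) \<le> c * (y j * tanh (a * y j))" for j
      using mult_tanh_strict_antimono[OF assms(2,3), of "y j"] by (cases "y j = 0") auto
    then show "\<forall>j\<in>{..<n}. a * (y j * tanh (c * y j)) \<le> c * (y j * tanh (a * y j))" by blast
    have "y i \<noteq> 0" using assms by (simp add: y_def)
    then show "\<exists>j\<in>{..<n}. a * (y j * tanh (c * y j)) < c * (y j * tanh (a * y j))"
      using mult_tanh_strict_antimono[OF assms(2,3), of "y i"] assms(4) by auto
  qed simp
  then show ?thesis
    by (simp add: bn_score_def y_def[symmetric] sum_distrib_left right_diff_distrib)
qed

text \<open>A supremum over countably many points, so that measurability in the sample is immediate.\<close>

definition bn_pos_root :: "real \<Rightarrow> real \<Rightarrow> real \<Rightarrow> nat \<Rightarrow> (nat \<Rightarrow> real) \<Rightarrow> real" where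
  "bn_pos_root \<mu> \<sigma> b n x = (SUP q \<in> \<rat> \<inter> {0<..<b}. if bn_score \<mu> \<sigma> n x q > 0 then q else 0)"

text \<open>The intermediate value theorem gives a root r between l and u. The score is positive on
  (0, r) and negative beyond r, so the supremum in the definition is r.\<close>

lemma bn_pos_root:
  assumes "\<sigma> > 0" "0 < l" "l < u" "u < b"
    and sl: "bn_score \<mu> \<sigma> n x l > 0" and su: "bn_score \<mu> \<sigma> n x u < 0"
  shows "l < bn_pos_root \<mu> \<sigma> b n x" "bn_pos_root \<mu> \<sigma> b n x < u"
    and "bn_score \<mu> \<sigma> n x (bn_pos_root \<mu> \<sigma> b n x) = 0"
proof -
  let ?s = "bn_score \<mu> \<sigma> n x"
  let ?f = "\<lambda>q. if ?s q > 0 then q else 0"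
  have "continuous_on {l..u} ?s"
    unfolding bn_score_def by (intro continuous_intros) auto
  then obtain r where r: "l \<le> r" "r \<le> u" "?s r = 0"
    using IVT2'[of ?s u 0 l] assms by auto
  then have lr: "l < r" "r < u" using sl su by (auto simp: less_le)
  \<comment> \<open>Strict monotonicity needs an observation other than \<mu>. Without one, which
    includes n = 0, the score at l would be - n l, contradicting its positivity.\<close>
  obtain i where i: "i < n" "x i \<noteq> \<mu>"
  proof (rule ccontr)
    assume "\<not> thesis"
    with that have "\<forall>i<n. x i = \<mu>" by blast
    then have "?s l = - real n * l" by (simp add: bn_score_def)
    with sl \<open>0 < l\<close> show False by (simp add: mult_less_0_iff)
  qed
  \<comment> \<open>Here and in \<open>above\<close>, q is compared with r, where the score is
    0.\<close>
  have below: "?s q > 0" if "0 < q" "q < r" for q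
    using bn_score_strict_antimono[where x = x, OF assms(1) that i] r(3) lr assms(2)
    by (simp add: zero_less_mult_iff)
  have above: "?s q < 0" if "r < q" for q
    using bn_score_strict_antimono[where x = x, OF assms(1) _ that i] r(3) lr assms(2)
    by (simp add: mult_less_0_iff)
  \<comment> \<open>The default value 0 lies below r and so does not disturb the supremum.\<close>
  have le: "?f q \<le> r" if "0 < q" for q
    using above[of q] lr assms(2) by (cases "r < q") auto
  let ?I = "\<rat> \<inter> {0<..<b}"
  have bdd: "bdd_above (?f ` ?I)" using le by (intro bdd_aboveI2[of _ _ r]) auto
  have "bn_pos_root \<mu> \<sigma> b n x = r"
    unfolding bn_pos_root_def
  proof (rule antisym)
    obtain q where "q \<in> \<rat>" "0 < q" "q < b"
      using Rats_dense_in_real[of 0 b] assms by auto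
    then have "?I \<noteq> {}" by auto
    then show "(SUP q\<in>?I. ?f q) \<le> r" using le by (intro cSUP_least) auto
    show "r \<le> (SUP q\<in>?I. ?f q)"
    proof (rule dense_le_bounded)
      show "0 < r" using lr assms by simp
      fix w assume w: "0 < w" "w < r"
      obtain q where q: "q \<in> \<rat>" "w < q" "q < r"
        using Rats_dense_in_real[OF w(2)] by auto
      \<comment> \<open>The cut-off b exceeds u, hence r, so no rational below r is lost.\<close>
      have "q \<in> ?I" using q w lr assms by auto
      then have "?f q \<le> (SUP q\<in>?I. ?f q)" by (rule cSUP_upper[OF _ bdd])
      with below[of q] q w show "w \<le> (SUP q\<in>?I. ?f q)" by auto
    qed
  qed
  then show "l < bn_pos_root \<mu> \<sigma> b n x" "bn_pos_root \<mu> \<sigma> b n x < u"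
    "?s (bn_pos_root \<mu> \<sigma> b n x) = 0"
    using lr r by auto
qed

section \<open>Measurability of the score and of the root\<close>

lemma borel_measurable_tanh [measurable (raw)]:
  fixes f :: "'a \<Rightarrow> real"
  assumes "f \<in> borel_measurable M"
  shows "(\<lambda>x. tanh (f x)) \<in> borel_measurable M"
proof -
  have "(tanh :: real \<Rightarrow> real) \<in> borel_measurable borel"
    by (intro borel_measurable_continuous_onI continuous_intros) auto
  with assms show ?thesis by measurable
qed

lemma borel_measurable_bn_score [measurable (raw)]:
  assumes "X \<in> measurable M (\<Pi>\<^sub>M i\<in>{..<n}. borel)" "f \<in> borel_measurable M"
  shows "(\<lambda>\<omega>. bn_score \<mu> \<sigma> n (X \<omega>) (f \<omega>)) \<in> borel_measurable M"
proof -
  note assms(2)[measurable]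
  have [measurable]: "(\<lambda>\<omega>. X \<omega> i) \<in> borel_measurable M" if "i < n" for i
    using measurable_compose[OF assms(1) measurable_component_singleton[of i]] that by simp
  have "(\<lambda>\<omega>. (X \<omega> i - \<mu>) / \<sigma> * tanh (f \<omega> * ((X \<omega> i - \<mu>) / \<sigma>))) \<in> borel_measurable M"
    if "i < n" for i using that by measurable
  then show ?thesis unfolding bn_score_def
    by (intro borel_measurable_diff borel_measurable_sum) (auto intro: assms)
qed

lemma borel_measurable_bn_pos_root:
  "bn_pos_root \<mu> \<sigma> b n \<in> borel_measurable (\<Pi>\<^sub>M i\<in>{..<n}. borel)"
  unfolding bn_pos_root_def[abs_def]
proof (rule borel_measurable_cSUP)
  show "countable (\<rat> \<inter> {0<..<b})" using countable_rat by blast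
  \<comment> \<open>The cut-off b bounds the family uniformly in the sample; \<open>max\<close> also
    covers the default value 0.\<close>
  show "bdd_above ((\<lambda>q. if bn_score \<mu> \<sigma> n x q > 0 then q else 0) ` (\<rat> \<inter> {0<..<b}))" for x
    by (rule bdd_aboveI2[of _ _ "max 0 b"]) auto
qed measurable

section \<open>Asymptotics of the score for a positive true parameter\<close>

text \<open>Here b plays the role of |\<alpha>|. The density is even in \<alpha>, so the law of the
  data is the same for both signs and a positive value suffices.\<close>

locale bn_sample = prob_space M
  for M :: "'a measure" and X :: "nat \<Rightarrow> 'a \<Rightarrow> real" and \<mu> \<sigma> b :: real +
  assumes \<sigma>_pos: "\<sigma> > 0" and b_pos: "b > 0"
    and indep: "indep_vars (\<lambda>_. borel) X UNIV"
    and distr: "\<And>i. distributed M lborel (X i) (\<lambda>x. ennreal (bn_density \<mu> \<sigma> b x))"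
begin

definition psi :: "real \<Rightarrow> real \<Rightarrow> real" where
  "psi a x = (x - \<mu>) / \<sigma> * tanh (a * ((x - \<mu>) / \<sigma>))"

definition mean_psi :: "real \<Rightarrow> real" where
  "mean_psi a = (\<integral>x. bn_density \<mu> \<sigma> b x * psi a x \<partial>lborel)"

lemma X_measurable [measurable]: "X i \<in> borel_measurable M"
  using distributed_measurable[OF distr] by simp

lemma psi_measurable [measurable]: "psi a \<in> borel_measurable borel"
  unfolding psi_def by measurable

lemma expectation_psi: "expectation (\<lambda>\<omega>. psi a (X i \<omega>)) = mean_psi a"
  unfolding mean_psi_def by (rule distributed_integral[OF distr, symmetric]) (auto simp: bn_density_nonneg)

text \<open>Since |tanh| is at most 1, \<open>psi a\<close> is dominated by the standardised
  observation, which has a finite second moment.\<close>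

lemma psi_square_integrable: "integrable M (\<lambda>\<omega>. (psi a (X i \<omega>))\<^sup>2)"
proof (rule Bochner_Integration.integrable_bound)
  show "integrable M (\<lambda>\<omega>. ((X i \<omega> - \<mu>) / \<sigma>)\<^sup>2)"
    using bn_second_moment_integrable[OF \<sigma>_pos, of \<mu> b]
    by (subst (asm) distributed_integrable[OF distr]) (auto simp: bn_density_nonneg)
  have "\<bar>psi a x\<bar> \<le> \<bar>(x - \<mu>) / \<sigma>\<bar>" for x
    unfolding psi_def abs_mult[of "(x - \<mu>) / \<sigma>"] by (intro mult_left_le abs_tanh_real_le_1) auto
  then have "(psi a x)\<^sup>2 \<le> ((x - \<mu>) / \<sigma>)\<^sup>2" for x by (simp only: abs_le_square_iff)
  then show "AE \<omega> in M. norm ((psi a (X i \<omega>))\<^sup>2) \<le> norm (((X i \<omega> - \<mu>) / \<sigma>)\<^sup>2)" by simp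
qed measurable

lemma psi_integrable: "integrable M (\<lambda>\<omega>. psi a (X i \<omega>))"
  by (rule square_integrable_imp_integrable[OF _ psi_square_integrable]) measurable

lemma psi_average:
  assumes "e > 0"
  shows "(\<lambda>n. prob {\<omega> \<in> space M. \<bar>(\<Sum>i<n. psi a (X i \<omega>)) - real n * mean_psi a\<bar> \<ge> real n * e})
    \<longlonglongrightarrow> 0"
proof (rule weak_law_of_large_numbers[OF _ psi_square_integrable expectation_psi _ assms])
  show "indep_vars (\<lambda>_. borel) (\<lambda>i \<omega>. psi a (X i \<omega>)) UNIV"
    by (rule indep_vars_compose2[OF indep]) auto
  \<comment> \<open>The weak law asks for one second moment common to all i; the integral against
    the shared density provides it.\<close>
  show "expectation (\<lambda>\<omega>. (psi a (X i \<omega>))\<^sup>2) = (\<integral>x. bn_density \<mu> \<sigma> b x * (psi a x)\<^sup>2 \<partial>lborel)" for i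
    by (rule distributed_integral[OF distr, symmetric]) (auto simp: bn_density_nonneg)
qed

text \<open>The pointwise inequality is strict unless the observation equals \<mu>, an event of
  probability 0, so strictness survives integration.\<close>

lemma mean_psi_strict_antimono:
  assumes "0 < a" "a < c"
  shows "a * mean_psi c < c * mean_psi a"
proof -
  have "AE \<omega> in M. X 0 \<omega> \<noteq> \<mu>"
    by (rule distributed_AE2[OF distr, THEN iffD2]) (auto intro: eventually_mono[OF AE_lborel_singleton])
  then have "AE \<omega> in M. a * psi c (X 0 \<omega>) < c * psi a (X 0 \<omega>)"
    unfolding psi_def
    by eventually_elim (rule mult_tanh_strict_antimono[OF assms], use \<sigma>_pos in simp)
  then have "expectation (\<lambda>\<omega>. a * psi c (X 0 \<omega>)) < expectation (\<lambda>\<omega>. c * psi a (X 0 \<omega>))"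
    by (intro integral_less_AE_space) (auto intro!: psi_integrable simp: emeasure_space_1)
  then show ?thesis by (simp add: expectation_psi)
qed

text \<open>The expected score per observation, \<open>mean_psi a - a\<close>, thus vanishes at the
  true value; monotonicity then gives its sign on either side.\<close>

lemma mean_psi_fixpoint: "mean_psi b = b"
  unfolding mean_psi_def psi_def by (rule bn_score_mean[OF \<sigma>_pos])

lemma score_sample:
  "bn_score \<mu> \<sigma> n (sample X n \<omega>) a = (\<Sum>i<n. psi a (X i \<omega>)) - real n * a"
  by (simp add: bn_score_def sample_def psi_def)

lemma sample_measurable [measurable]: "sample X n \<in> measurable M (\<Pi>\<^sub>M i\<in>{..<n}. borel)"
  unfolding sample_def[abs_def] by (intro measurable_restrict) measurable

text \<open>A nonpositive score at l forces the sum of the \<open>psi l\<close> to fall short of its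
  mean by at least n times the gap \<open>mean_psi l - l\<close>, which the weak law makes unlikely.
  The gap is positive because \<open>l * b < b * mean_psi l\<close>.\<close>

lemma score_pos_below:
  assumes "0 < l" "l < b"
  shows "(\<lambda>n. prob {\<omega> \<in> space M. bn_score \<mu> \<sigma> n (sample X n \<omega>) l \<le> 0}) \<longlonglongrightarrow> 0"
proof -
  have e: "mean_psi l - l > 0"
    using mean_psi_strict_antimono[OF assms] b_pos by (simp add: mean_psi_fixpoint mult.commute)
  show ?thesis
  proof (rule tendsto_sandwich[OF _ _ tendsto_const psi_average[OF e, of l]])
    show "\<forall>\<^sub>F n in sequentially. prob {\<omega> \<in> space M. bn_score \<mu> \<sigma> n (sample X n \<omega>) l \<le> 0} \<le>
      prob {\<omega> \<in> space M. \<bar>(\<Sum>i<n. psi l (X i \<omega>)) - real n * mean_psi l\<bar> \<ge> real n * (mean_psi l - l)}"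
      by (intro always_eventually allI finite_measure_mono) (auto simp: score_sample algebra_simps)
  qed simp
qed

text \<open>Mirror image of the previous lemma: a nonnegative score at u is an upward deviation by
  at least n times \<open>u - mean_psi u\<close>.\<close>

lemma score_neg_above:
  assumes "b < u"
  shows "(\<lambda>n. prob {\<omega> \<in> space M. bn_score \<mu> \<sigma> n (sample X n \<omega>) u \<ge> 0}) \<longlonglongrightarrow> 0"
proof -
  have e: "u - mean_psi u > 0"
    using mean_psi_strict_antimono[OF b_pos assms] b_pos by (simp add: mean_psi_fixpoint mult.commute)
  show ?thesis
  proof (rule tendsto_sandwich[OF _ _ tendsto_const psi_average[OF e, of u]])
    show "\<forall>\<^sub>F n in sequentially. prob {\<omega> \<in> space M. bn_score \<mu> \<sigma> n (sample X n \<omega>) u \<ge> 0} \<le>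
      prob {\<omega> \<in> space M. \<bar>(\<Sum>i<n. psi u (X i \<omega>)) - real n * mean_psi u\<bar> \<ge> real n * (u - mean_psi u)}"
      by (intro always_eventually allI finite_measure_mono) (auto simp: score_sample algebra_simps)
  qed simp
qed

text \<open>Failure requires a wrong sign of the score at \<open>b - d\<close> or at
  \<open>b + d\<close>. The three properties are bundled so that both the existence of a root and
  its consistency can be read off.\<close>

lemma pos_root_consistent:
  assumes "\<epsilon> > 0"
  shows "(\<lambda>n. prob {\<omega> \<in> space M. \<not> (
      bn_pos_root \<mu> \<sigma> (2 * b) n (sample X n \<omega>) > 0 \<and>
      bn_score \<mu> \<sigma> n (sample X n \<omega>) (bn_pos_root \<mu> \<sigma> (2 * b) n (sample X n \<omega>)) = 0 \<and>
      \<bar>bn_pos_root \<mu> \<sigma> (2 * b) n (sample X n \<omega>) - b\<bar> \<le> \<epsilon>)}) \<longlonglongrightarrow> 0"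
    (is "(\<lambda>n. prob (?B n)) \<longlonglongrightarrow> 0")
proof -
  \<comment> \<open>The bound \<epsilon> gives closeness; \<open>b / 2\<close> keeps
    \<open>b - d\<close> positive and \<open>b + d\<close> below the cut-off
    \<open>2 * b\<close>.\<close>
  define d where "d = min \<epsilon> (b / 2)"
  have d: "0 < d" "d \<le> \<epsilon>" "d < b" using assms b_pos by (auto simp: d_def)
  let ?L = "\<lambda>n. {\<omega> \<in> space M. bn_score \<mu> \<sigma> n (sample X n \<omega>) (b - d) \<le> 0}"
  let ?U = "\<lambda>n. {\<omega> \<in> space M. bn_score \<mu> \<sigma> n (sample X n \<omega>) (b + d) \<ge> 0}"
  have "(\<lambda>n. prob (?L n) + prob (?U n)) \<longlonglongrightarrow> 0 + 0"
    using d by (intro tendsto_add score_pos_below score_neg_above) auto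
  then have lim: "(\<lambda>n. prob (?L n) + prob (?U n)) \<longlonglongrightarrow> 0" by simp
  have "prob (?B n) \<le> prob (?L n) + prob (?U n)" for n
  proof -
    have "?B n \<subseteq> ?L n \<union> ?U n"
    proof (rule ccontr)
      assume "\<not> ?thesis"
      then obtain \<omega> where \<omega>: "\<omega> \<in> ?B n" "\<not> bn_score \<mu> \<sigma> n (sample X n \<omega>) (b - d) \<le> 0"
        "\<not> bn_score \<mu> \<sigma> n (sample X n \<omega>) (b + d) \<ge> 0" by blast
      have *: "0 < b - d" "b - d < b + d" "b + d < 2 * b" using d by auto
      note bn_pos_root[OF \<sigma>_pos *, of \<mu> n "sample X n \<omega>"]
      with \<omega> d show False by auto
    qed
    then have "prob (?B n) \<le> prob (?L n \<union> ?U n)" by (rule finite_measure_mono) measurable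
    also have "\<dots> \<le> prob (?L n) + prob (?U n)" by (rule measure_Un_le) measurable
    finally show ?thesis .
  qed
  then show ?thesis
    by (intro tendsto_sandwich[OF _ _ tendsto_const lim] always_eventually allI) auto
qed

end

section \<open>Transfer from |\<alpha>| to a true value of either sign\<close>

theorem theorem6p3:
  fixes M :: "'a measure" and X :: "nat \<Rightarrow> 'a \<Rightarrow> real" and \<mu> \<sigma> \<alpha> :: real
  assumes "prob_space M"
    and "\<sigma> > 0"
    and "\<alpha> \<in> bn_alpha_space"
    and "prob_space.indep_vars M (\<lambda>_. borel) X UNIV"
    and "\<And>i. distributed M lborel (X i) (\<lambda>x. ennreal (bn_density \<mu> \<sigma> \<alpha> x))"
  shows "\<exists>\<alpha>hat :: nat \<Rightarrow> (nat \<Rightarrow> real) \<Rightarrow> real.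
    (\<forall>n. \<alpha>hat n \<in> borel_measurable (\<Pi>\<^sub>M i\<in>{..<n}. borel)) \<and>
    (\<lambda>n. measure M {\<omega> \<in> space M.
        bn_lik_root \<mu> \<sigma> n (sample X n \<omega>) (\<alpha>hat n (sample X n \<omega>))}) \<longlonglongrightarrow> 1 \<and>
    tendsto_in_prob M (\<lambda>n \<omega>. \<alpha>hat n (sample X n \<omega>)) \<alpha>"
proof -
  have \<alpha>: "\<alpha> \<noteq> 0" using assms(3) by (simp add: bn_alpha_space_def)
  have even: "bn_density \<mu> \<sigma> \<alpha> = bn_density \<mu> \<sigma> \<bar>\<alpha>\<bar>"
    by (cases "\<alpha> \<ge> 0") (auto simp: bn_density_def fun_eq_iff)
  interpret bn_sample M X \<mu> \<sigma> "\<bar>\<alpha>\<bar>"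
    using assms \<alpha> by (intro bn_sample.intro bn_sample_axioms.intro) (auto simp: even)
  define r where "r n x = bn_pos_root \<mu> \<sigma> (2 * \<bar>\<alpha>\<bar>) n x" for n x
  define h where "h n x = sgn \<alpha> * r n x" for n x
  have r_meas[measurable]: "r n \<in> borel_measurable (\<Pi>\<^sub>M i\<in>{..<n}. borel)" for n
    unfolding r_def[abs_def] by (rule borel_measurable_bn_pos_root)
  have h_meas[measurable]: "h n \<in> borel_measurable (\<Pi>\<^sub>M i\<in>{..<n}. borel)" for n
    unfolding h_def[abs_def] by measurable
  \<comment> \<open>The score is odd, so attaching the sign of \<alpha> preserves its zeros.\<close>
  have root: "bn_lik_root \<mu> \<sigma> n x (h n x) \<longleftrightarrow> r n x \<noteq> 0 \<and> bn_score \<mu> \<sigma> n x (r n x) = 0" for n x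
    using \<alpha> by (cases "\<alpha> > 0") (auto simp: bn_lik_root_iff[OF assms(2)] h_def bn_score_minus)
  have dist: "\<bar>h n x - \<alpha>\<bar> = \<bar>r n x - \<bar>\<alpha>\<bar>\<bar>" for n x
    using \<alpha> by (cases "\<alpha> > 0") (auto simp: h_def)
  let ?B = "\<lambda>\<epsilon> n. {\<omega> \<in> space M. \<not> (r n (sample X n \<omega>) > 0 \<and>
      bn_score \<mu> \<sigma> n (sample X n \<omega>) (r n (sample X n \<omega>)) = 0 \<and>
      \<bar>r n (sample X n \<omega>) - \<bar>\<alpha>\<bar>\<bar> \<le> \<epsilon>)}"
  have B: "(\<lambda>n. prob (?B \<epsilon> n)) \<longlonglongrightarrow> 0" if "\<epsilon> > 0" for \<epsilon>
    using pos_root_consistent[OF that] unfolding r_def .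
  have B_meas[measurable]: "?B \<epsilon> n \<in> sets M" for \<epsilon> n by measurable
  let ?R = "\<lambda>n. {\<omega> \<in> space M. bn_lik_root \<mu> \<sigma> n (sample X n \<omega>) (h n (sample X n \<omega>))}"
  \<comment> \<open>Rewriting by \<open>root\<close> replaces the derivative condition by an
    equation between measurable functions.\<close>
  have R_meas: "?R n \<in> sets M" for n unfolding root by measurable
  have "(\<lambda>n. prob (?R n)) \<longlonglongrightarrow> 1"
  proof (rule tendsto_sandwich[OF _ _ _ tendsto_const])
    \<comment> \<open>The tolerance 1 is arbitrary: only the root property is used here, not the
      closeness.\<close>
    show "(\<lambda>n. 1 - prob (?B 1 n)) \<longlonglongrightarrow> 1"
      using tendsto_diff[OF tendsto_const[of 1] B[of 1]] by simp
    have "1 - prob (?B 1 n) \<le> prob (?R n)" for n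
    proof -
      have "1 - prob (?B 1 n) = prob (space M - ?B 1 n)" by (rule prob_compl[OF B_meas, symmetric])
      also have "\<dots> \<le> prob (?R n)" by (rule finite_measure_mono[OF _ R_meas]) (auto simp: root)
      finally show ?thesis .
    qed
    then show "\<forall>\<^sub>F n in sequentially. 1 - prob (?B 1 n) \<le> prob (?R n)" by simp
  qed simp
  moreover have "tendsto_in_prob M (\<lambda>n \<omega>. h n (sample X n \<omega>)) \<alpha>"
    unfolding tendsto_in_prob_def
  proof (intro conjI allI impI)
    fix \<epsilon> :: real assume "\<epsilon> > 0"
    show "(\<lambda>n. prob {\<omega> \<in> space M. \<bar>h n (sample X n \<omega>) - \<alpha>\<bar> > \<epsilon>}) \<longlonglongrightarrow> 0"
    proof (rule tendsto_sandwich[OF _ _ tendsto_const B[OF \<open>\<epsilon> > 0\<close>]])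
      have "prob {\<omega> \<in> space M. \<bar>h n (sample X n \<omega>) - \<alpha>\<bar> > \<epsilon>} \<le> prob (?B \<epsilon> n)" for n
        by (rule finite_measure_mono[OF _ B_meas]) (auto simp: dist)
      then show "\<forall>\<^sub>F n in sequentially.
          prob {\<omega> \<in> space M. \<bar>h n (sample X n \<omega>) - \<alpha>\<bar> > \<epsilon>} \<le> prob (?B \<epsilon> n)"
        by simp
    qed simp
  qed measurable
  ultimately show ?thesis using h_meas by blast
qed

end
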